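(* Let $\mathbb{K}$ be an algebraically closed field, $V$ a $\mathbb{K}$-vector space of finite positive dimension, and $\Phi=(A;\{E_i\}_{i=0}^d;A^*;\{E_i^*\}_{i=0}^d)$ a TD system on $V$ of diameter $d\geq 1$ that has $q$-Racah type, with fixed associated scalars $q,a,b$, and with $\theta_i^*$ the eigenvalue of $A^*$ on $E_i^*V$. Let the subspaces $W_i$ be as defined in the context. Then for $0\leq i\leq d$, $$(A^*-\theta_i^*I)W_i\subseteq W_0+W_1+\cdots +W_{i-1}.$$
   Context: TD pair: an ordered pair of linear maps $A,A^*:V\to V$ such that (i) each is diagonalizable; (ii) there is an ordering $\{V_i\}_{i=0}^d$ of the eigenspaces of $A$ with $A^*V_i\subseteq V_{i-1}+V_i+V_{i+1}$ for $0\le i\le d$ ($V_{-1}=V_{d+1}=0$); (iii) there is an ordering $\{V_i^*\}_{i=0}^\delta$ of the eigenspaces of $A^*$ with $AV_i^*\subseteq V_{i-1}^*+V_i^*+V_{i+1}^*$ for $0\le i\le\delta$ ($V^*_{-1}=V^*_{\delta+1}=0$); (iv) no subspace $W$ with $0\ne W\ne V$ satisfies $AW\subseteq W$ and $A^*W\subseteq W$. It is known that $d=\delta$; $d$ is called the diameter. Orderings as in (ii), (iii) are called standard. The primitive idempotent of $A$ for an eigenspace $V_i$ is the projection of $V$ onto $V_i$ that vanishes on the other eigenspaces (similarly for $A^*$). TD system: $(A;\{E_i\}_{i=0}^d;A^*;\{E_i^*\}_{i=0}^d)$ where $A,A^*$ is a TD pair and $\{E_i\}$, $\{E_i^*\}$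 are the primitive idempotents of $A$, $A^*$, in orders for which the corresponding eigenspace orderings $\{E_iV\}$, $\{E_i^*V\}$ are standard. Let $\theta_i$ (resp. $\theta_i^*$) be the eigenvalue of $A$ on $E_iV$ (resp. of $A^*$ on $E_i^*V$). $\Phi$ has $q$-Racah type if there are nonzero $q,a,b\in\mathbb{K}$ with $q^4\ne1$ and $\theta_i=aq^{d-2i}+a^{-1}q^{2i-d}$, $\theta_i^*=bq^{d-2i}+b^{-1}q^{2i-d}$ for $0\le i\le d$. (Distinctness of eigenvalues forces $q^{2i}\neq1$ for $1\le i\le d$, and $a^2\ne q^{2d-2},q^{2d-4},\dots,q^{2-2d}$; in particular $a^2\neq 1$.) Split decompositions: $U_i=(E_0^*V+\cdots+E_i^*V)\cap(E_iV+\cdots+E_dV)$ and $U_i^\Downarrow=(E_0^*V+\cdots+E_i^*V)\cap(E_0V+\cdots+E_{d-i}V)$ for $0\le i\le d$. It is known that $V=\bigoplus_i U_i=\bigoplus_i U_i^\Downarrow$ with all summands nonzero. $K,B\in\mathrm{End}(V)$ are the linear maps acting on $U_i$, respectively $U_i^\Downarrow$, as the scalar $q^{d-2i}$ ($0\le i\le d$). $\mathcal{M}=\dfrac{aK-a^{-1}B}{a-a^{-1}}\in\mathrm{End}(V)$, and $W_i=\{v\in V:\mathcal{M}v=q^{d-2i}v\}$ is the eigenspace of $\mathcal{M}$ for the eigenvalue $q^{d-2i}$ ($0\le i\le d$). Empty sums of subspaces are $0$. *)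

theory Defs
  imports
    "HOL-Computational_Algebra.Computational_Algebra"
    "HOL-Library.Set_Algebras"
begin

(* Sums of subspaces are the elementwise sums of Set_Algebras: S + T = {s + t | s : S, t : T}, with
   the set 0 = {0} as neutral element.  In particular an empty sum of sets is the zero subspace. *)

(* A copy of vector_space without further assumptions.  Definitions made in vector_space itself would
   also be instantiated by its global interpretation real_vector, which shadows their names. *)
locale TD_space = vector_space scale
  for scale :: "'a::field \<Rightarrow> 'b::ab_group_add \<Rightarrow> 'b" (infixr \<open>*s\<close> 75)
begin

definition eigenspace :: "('b \<Rightarrow> 'b) \<Rightarrow> 'a \<Rightarrow> 'b set" where
  "eigenspace f \<theta> = {v. f v = \<theta> *s v}"

(* Only the nonzero eigenspaces, i.e. those belonging to actual eigenvalues. *)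
definition eigenspaces :: "('b \<Rightarrow> 'b) \<Rightarrow> 'b set set" where
  "eigenspaces f = {eigenspace f \<theta> |\<theta>. eigenspace f \<theta> \<noteq> {0}}"

definition diagonalizable :: "('b \<Rightarrow> 'b) \<Rightarrow> bool" where
  "diagonalizable f \<longleftrightarrow> span (\<Union> (eigenspaces f)) = UNIV"

(* The eigenspaces of f are ordered as Vs 0, ..., Vs d; values of Vs beyond d are irrelevant.
   The conditionals implement the convention that the terms with index -1 and d + 1 are zero. *)
definition standard_ordering ::
    "('b \<Rightarrow> 'b) \<Rightarrow> ('b \<Rightarrow> 'b) \<Rightarrow> nat \<Rightarrow> (nat \<Rightarrow> 'b set) \<Rightarrow> bool" where
  "standard_ordering f g d Vs \<longleftrightarrow>
     bij_betw Vs {..d} (eigenspaces f) \<and>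
     (\<forall>i\<le>d. g ` Vs i \<subseteq>
        (if i = 0 then {0} else Vs (i - 1)) + Vs i + (if i = d then {0} else Vs (i + 1)))"

definition TD_pair :: "('b \<Rightarrow> 'b) \<Rightarrow> ('b \<Rightarrow> 'b) \<Rightarrow> bool" where
  "TD_pair A As \<longleftrightarrow>
     Vector_Spaces.linear scale scale A \<and> Vector_Spaces.linear scale scale As \<and>
     diagonalizable A \<and> diagonalizable As \<and>
     (\<exists>d Vs. standard_ordering A As d Vs) \<and>
     (\<exists>\<delta> Vs. standard_ordering As A \<delta> Vs) \<and>
     \<not> (\<exists>W. subspace W \<and> W \<noteq> {0} \<and> W \<noteq> UNIV \<and> A ` W \<subseteq> W \<and> As ` W \<subseteq> W)"

definition primitive_idempotent :: "('b \<Rightarrow> 'b) \<Rightarrow> 'b set \<Rightarrow> ('b \<Rightarrow> 'b) \<Rightarrow> bool" where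
  "primitive_idempotent f U P \<longleftrightarrow>
     U \<in> eigenspaces f \<and> Vector_Spaces.linear scale scale P \<and>
     range P = U \<and> (\<forall>v\<in>U. P v = v) \<and>
     (\<forall>U'\<in>eigenspaces f. U' \<noteq> U \<longrightarrow> (\<forall>v\<in>U'. P v = 0))"

definition TD_system ::
    "nat \<Rightarrow> ('b \<Rightarrow> 'b) \<Rightarrow> (nat \<Rightarrow> 'b \<Rightarrow> 'b) \<Rightarrow> ('b \<Rightarrow> 'b) \<Rightarrow> (nat \<Rightarrow> 'b \<Rightarrow> 'b) \<Rightarrow> bool" where
  "TD_system d A E As Es \<longleftrightarrow>
     TD_pair A As \<and>
     (\<forall>i\<le>d. primitive_idempotent A (range (E i)) (E i)) \<and>
     (\<forall>i\<le>d. primitive_idempotent As (range (Es i)) (Es i)) \<and>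
     standard_ordering A As d (\<lambda>i. range (E i)) \<and>
     standard_ordering As A d (\<lambda>i. range (Es i))"

(* Meaningful when U is a nonzero subspace on which f acts as a scalar. *)
definition eigenvalue_on :: "('b \<Rightarrow> 'b) \<Rightarrow> 'b set \<Rightarrow> 'a" where
  "eigenvalue_on f U = (THE \<theta>. \<forall>v\<in>U. f v = \<theta> *s v)"

lemma eigenvalue_on_eqI:
  assumes "u \<in> U" "u \<noteq> 0" "\<And>v. v \<in> U \<Longrightarrow> f v = \<theta> *s v"
  shows "eigenvalue_on f U = \<theta>"
  unfolding eigenvalue_on_def
proof (rule the_equality)
  fix \<theta>' assume "\<forall>v\<in>U. f v = \<theta>' *s v"
  then have "\<theta>' *s u = \<theta> *s u" using assms(1) assms(3)[OF assms(1)] by metis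
  then show "\<theta>' = \<theta>" using assms(2) by (rule scale_right_imp_eq[rotated])
qed (use assms(3) in simp)

definition q_Racah ::
    "nat \<Rightarrow> ('b \<Rightarrow> 'b) \<Rightarrow> (nat \<Rightarrow> 'b \<Rightarrow> 'b) \<Rightarrow> ('b \<Rightarrow> 'b) \<Rightarrow> (nat \<Rightarrow> 'b \<Rightarrow> 'b) \<Rightarrow> 'a \<Rightarrow> 'a \<Rightarrow> 'a \<Rightarrow> bool"
  where
  "q_Racah d A E As Es q a b \<longleftrightarrow>
     q \<noteq> 0 \<and> a \<noteq> 0 \<and> b \<noteq> 0 \<and> q ^ 4 \<noteq> 1 \<and>
     (\<forall>i\<le>d. eigenvalue_on A (range (E i)) =
        a * q powi (int d - 2 * int i) + inverse a * q powi (2 * int i - int d)) \<and>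
     (\<forall>i\<le>d. eigenvalue_on As (range (Es i)) =
        b * q powi (int d - 2 * int i) + inverse b * q powi (2 * int i - int d))"

definition split_U ::
    "nat \<Rightarrow> (nat \<Rightarrow> 'b \<Rightarrow> 'b) \<Rightarrow> (nat \<Rightarrow> 'b \<Rightarrow> 'b) \<Rightarrow> nat \<Rightarrow> 'b set" where
  "split_U d E Es i = (\<Sum>j\<in>{0..i}. range (Es j)) \<inter> (\<Sum>j\<in>{i..d}. range (E j))"

definition split_U_down ::
    "nat \<Rightarrow> (nat \<Rightarrow> 'b \<Rightarrow> 'b) \<Rightarrow> (nat \<Rightarrow> 'b \<Rightarrow> 'b) \<Rightarrow> nat \<Rightarrow> 'b set" where
  "split_U_down d E Es i = (\<Sum>j\<in>{0..i}. range (Es j)) \<inter> (\<Sum>j\<in>{0..d - i}. range (E j))"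

(* For a decomposition V = U 0 + ... + U d (direct) this determines the linear map F uniquely. *)
definition acts_on_decomposition ::
    "nat \<Rightarrow> 'a \<Rightarrow> (nat \<Rightarrow> 'b set) \<Rightarrow> ('b \<Rightarrow> 'b) \<Rightarrow> bool" where
  "acts_on_decomposition d q U F \<longleftrightarrow>
     Vector_Spaces.linear scale scale F \<and>
     (\<forall>i\<le>d. \<forall>v\<in>U i. F v = q powi (int d - 2 * int i) *s v)"

definition M_map :: "'a \<Rightarrow> ('b \<Rightarrow> 'b) \<Rightarrow> ('b \<Rightarrow> 'b) \<Rightarrow> 'b \<Rightarrow> 'b" where
  "M_map a K B v = inverse (a - inverse a) *s (a *s K v - inverse a *s B v)"

definition W_space ::
    "nat \<Rightarrow> 'a \<Rightarrow> 'a \<Rightarrow> ('b \<Rightarrow> 'b) \<Rightarrow> ('b \<Rightarrow> 'b) \<Rightarrow> nat \<Rightarrow> 'b set" where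
  "W_space d q a K B i = eigenspace (M_map a K B) (q powi (int d - 2 * int i))"

end

end

theory Submission
  imports Defs
begin

text \<open>Put \<open>L n = E\<^sub>0\<^sup>*V + \<dots> + E\<^sub>n\<^sub>-\<^sub>1\<^sup>*V\<close>.  By irreducibility \<open>L n\<close> is the sum of the first \<open>n\<close> components
  of either split decomposition, so \<open>K\<close> and \<open>B\<close>, and therefore also \<open>\<M>\<close>, stabilise this flag and
  act on \<open>L (n + 1) / L n\<close> as \<open>q\<^sup>d\<^sup>-\<^sup>2\<^sup>n\<close>.  These scalars are distinct, hence \<open>L n = W\<^sub>0 + \<dots> + W\<^sub>n\<^sub>-\<^sub>1\<close>.
  The claim follows because \<open>A\<^sup>* - \<theta>\<^sub>n\<^sup>* I\<close> maps \<open>L (n + 1)\<close> into \<open>L n\<close>.\<close>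

context TD_space
begin

section \<open>Sums, spans and partial sums of sequences of subspaces\<close>

lemma span_Un_set_plus: "span (X \<union> Y) = span X + span Y"
  unfolding span_Un set_plus_def by blast

text \<open>Translates the elementwise sums of the definitions into spans, the form in which partial
  sums are handled below.\<close>

lemma sum_eq_span:
  assumes "finite I" "\<And>i. i \<in> I \<Longrightarrow> subspace (S i)"
  shows "(\<Sum>i\<in>I. S i) = span (\<Union>i\<in>I. S i)"
proof -
  have "(\<Sum>i\<in>I. S i) = (\<Sum>i\<in>I. span (S i))"
    using assms(2) by (intro sum.cong refl) (metis span_eq_iff)
  also have "\<dots> = span (\<Union>i\<in>I. S i)"
    using assms(1) by (induction I rule: finite_induct) (simp_all add: span_Un_set_plus set_zero)
  finally show ?thesis .
qed

lemma linear_shift: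
  assumes "Vector_Spaces.linear scale scale f"
  shows "Vector_Spaces.linear scale scale (\<lambda>x. f x - c *s x)"
proof -
  interpret f: Vector_Spaces.linear scale scale f by fact
  show ?thesis
    by unfold_locales (auto simp: f.add f.scale algebra_simps)
qed

text \<open>The preimage of a subspace under a linear map is a subspace, so only generators need
  checking. This reduces claims about partial sums to single components.\<close>

lemma linear_span_into:
  assumes f: "Vector_Spaces.linear scale scale f" and T: "subspace T"
    and X: "\<And>x. x \<in> X \<Longrightarrow> f x \<in> T" and x: "x \<in> span X"
  shows "f x \<in> T"
proof -
  interpret f: Vector_Spaces.linear scale scale f by fact
  have "subspace {x. f x \<in> T}"
    using T unfolding subspace_def by (auto simp: f.add f.scale f.zero)
  then have "span X \<subseteq> {x. f x \<in> T}" by (intro span_minimal) (auto simp: X)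
  then show ?thesis using x by auto
qed

lemma subspace_cancel_add:
  assumes "subspace T" "y \<in> T" "x - y \<in> T"
  shows "x \<in> T"
  using subspace_add[OF assms(1) assms(3) assms(2)] by simp

text \<open>Sequences indexed by all of \<open>nat\<close>: a finite one is continued by zero subspaces, which
  makes the boundary conventions for the indices \<open>-1\<close> and \<open>d + 1\<close> disappear.  In
  \<open>tridiagonal_on\<close> the truncated \<open>0 - 1\<close> only repeats \<open>V 0\<close>.\<close>

definition lower_sum :: "(nat \<Rightarrow> 'b set) \<Rightarrow> nat \<Rightarrow> 'b set" where
  "lower_sum V n = span (\<Union>j<n. V j)"

definition upper_sum :: "(nat \<Rightarrow> 'b set) \<Rightarrow> nat \<Rightarrow> 'b set" where
  "upper_sum V n = span (\<Union>j\<in>{n..}. V j)"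

lemma subspace_lower_sum: "subspace (lower_sum V n)"
  unfolding lower_sum_def by (rule subspace_span)

lemma subspace_upper_sum: "subspace (upper_sum V n)"
  unfolding upper_sum_def by (rule subspace_span)

lemma lower_sum_0: "lower_sum V 0 = {0}"
  by (simp add: lower_sum_def)

lemma lower_sum_mono: "m \<le> n \<Longrightarrow> lower_sum V m \<subseteq> lower_sum V n"
  unfolding lower_sum_def by (rule span_mono) force

lemma upper_sum_antimono: "m \<le> n \<Longrightarrow> upper_sum V n \<subseteq> upper_sum V m"
  unfolding upper_sum_def by (rule span_mono) force

lemma subset_lower_sum: "j < n \<Longrightarrow> V j \<subseteq> lower_sum V n"
  unfolding lower_sum_def by (intro subsetI span_base) auto

lemma subset_upper_sum: "n \<le> j \<Longrightarrow> V j \<subseteq> upper_sum V n"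
  unfolding upper_sum_def by (intro subsetI span_base) auto

definition tridiagonal_on :: "('b \<Rightarrow> 'b) \<Rightarrow> (nat \<Rightarrow> 'b set) \<Rightarrow> bool" where
  "tridiagonal_on f V \<longleftrightarrow> (\<forall>j. f ` V j \<subseteq> span (V (j - 1) \<union> V j \<union> V (Suc j)))"

section \<open>Eigenvalue shifts and tridiagonal maps acting on partial sums\<close>

text \<open>The shift by \<open>\<theta> n\<close> kills the top component and rescales the others.
  The \<open>V j\<close> need not be full eigenspaces: the lemma serves the eigenspaces of
  \<open>As\<close> as well as the split components, on which the action is known only for indices
  up to \<open>d\<close>.\<close>

lemma eigen_lower_sum:
  assumes f: "Vector_Spaces.linear scale scale f"
    and eig: "\<And>j v. j \<le> n \<Longrightarrow> v \<in> V j \<Longrightarrow> f v = \<theta> j *s v"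
    and x: "x \<in> lower_sum V (Suc n)"
  shows "f x - \<theta> n *s x \<in> lower_sum V n"
proof (rule linear_span_into[OF linear_shift[OF f] subspace_lower_sum _ x[unfolded lower_sum_def]])
  fix y assume "y \<in> (\<Union>j<Suc n. V j)"
  then obtain j where j: "j < Suc n" "y \<in> V j" by auto
  have e: "f y - \<theta> n *s y = (\<theta> j - \<theta> n) *s y"
    using eig[of j y] j by (simp add: algebra_simps)
  show "f y - \<theta> n *s y \<in> lower_sum V n"
  proof (cases "j = n")
    case True then show ?thesis using e subspace_0[OF subspace_lower_sum] by simp
  next
    case False
    then have "y \<in> lower_sum V n" using j subset_lower_sum[of j n V] by auto
    then show ?thesis using e subspace_scale[OF subspace_lower_sum] by simp
  qed
qed

lemma eigen_upper_sum:
  assumes f: "Vector_Spaces.linear scale scale f" and eig: "\<And>j v. v \<in> V j \<Longrightarrow> f v = \<theta> j *s v"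
    and x: "x \<in> upper_sum V n"
  shows "f x - \<theta> n *s x \<in> upper_sum V (Suc n)"
proof (rule linear_span_into[OF linear_shift[OF f] subspace_upper_sum _ x[unfolded upper_sum_def]])
  fix y assume "y \<in> (\<Union>j\<in>{n..}. V j)"
  then obtain j where j: "n \<le> j" "y \<in> V j" by auto
  have e: "f y - \<theta> n *s y = (\<theta> j - \<theta> n) *s y" using eig[OF j(2)] by (simp add: algebra_simps)
  show "f y - \<theta> n *s y \<in> upper_sum V (Suc n)"
  proof (cases "j = n")
    case True then show ?thesis using e subspace_0[OF subspace_upper_sum] by simp
  next
    case False
    then have "y \<in> upper_sum V (Suc n)" using j subset_upper_sum[of "Suc n" j V] by auto
    then show ?thesis using e subspace_scale[OF subspace_upper_sum] by simp
  qed
qed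

lemma tridiagonal_lower_sum:
  assumes f: "Vector_Spaces.linear scale scale f" and tri: "tridiagonal_on f V"
    and x: "x \<in> lower_sum V n"
  shows "f x \<in> lower_sum V (Suc n)"
proof (rule linear_span_into[OF f subspace_lower_sum _ x[unfolded lower_sum_def]])
  fix y assume "y \<in> (\<Union>j<n. V j)"
  then obtain j where j: "j < n" "y \<in> V j" by auto
  have "f y \<in> span (V (j - 1) \<union> V j \<union> V (Suc j))" using tri j unfolding tridiagonal_on_def by blast
  also have "\<dots> \<subseteq> lower_sum V (Suc n)"
    using j by (intro span_minimal subspace_lower_sum Un_least subset_lower_sum) auto
  finally show "f y \<in> lower_sum V (Suc n)" .
qed

lemma tridiagonal_upper_sum:
  assumes f: "Vector_Spaces.linear scale scale f" and tri: "tridiagonal_on f V"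
    and x: "x \<in> upper_sum V (Suc n)"
  shows "f x \<in> upper_sum V n"
proof (rule linear_span_into[OF f subspace_upper_sum _ x[unfolded upper_sum_def]])
  fix y assume "y \<in> (\<Union>j\<in>{Suc n..}. V j)"
  then obtain j where j: "Suc n \<le> j" "y \<in> V j" by auto
  have "f y \<in> span (V (j - 1) \<union> V j \<union> V (Suc j))" using tri j unfolding tridiagonal_on_def by blast
  also have "\<dots> \<subseteq> upper_sum V n"
    using j by (intro span_minimal subspace_upper_sum Un_least subset_upper_sum) auto
  finally show "f y \<in> upper_sum V n" .
qed

section \<open>Irreducibility and the split decomposition\<close>

definition irreducible_pair :: "('b \<Rightarrow> 'b) \<Rightarrow> ('b \<Rightarrow> 'b) \<Rightarrow> bool" where
  "irreducible_pair f g \<longleftrightarrow>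
     \<not> (\<exists>W. subspace W \<and> W \<noteq> {0} \<and> W \<noteq> UNIV \<and> f ` W \<subseteq> W \<and> g ` W \<subseteq> W)"

text \<open>For \<open>r = 0\<close> the invariant subspace below is the sum of the split components; for \<open>r > 0\<close>
  it lies in \<open>upper_sum V 1\<close> and hence vanishes.\<close>

lemma diagonal_sum_trivial:
  fixes r :: nat
  assumes A: "Vector_Spaces.linear scale scale A" and As: "Vector_Spaces.linear scale scale As"
    and irr: "irreducible_pair A As"
    and V: "\<And>j v. v \<in> V j \<Longrightarrow> A v = \<theta> j *s v" "tridiagonal_on As V"
    and Vs: "\<And>j v. v \<in> Vs j \<Longrightarrow> As v = \<theta>s j *s v" "tridiagonal_on A Vs"
  defines "X \<equiv> span (\<Union>i. lower_sum Vs (Suc i) \<inter> upper_sum V (i + r))"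
  shows "X = {0} \<or> X = UNIV"
proof -
  have sX: "subspace X" unfolding X_def by (rule subspace_span)
  have inX: "x \<in> X" if "x \<in> lower_sum Vs (Suc i)" "x \<in> upper_sum V (i + r)" for x i
    unfolding X_def using that by (intro span_base) blast
  have "A x \<in> X" if "x \<in> X" for x
  proof (rule linear_span_into[OF A sX _ that[unfolded X_def]])
    fix y assume "y \<in> (\<Union>i. lower_sum Vs (Suc i) \<inter> upper_sum V (i + r))"
    then obtain i where y: "y \<in> lower_sum Vs (Suc i)" "y \<in> upper_sum V (i + r)" by auto
    \<comment> \<open>The shifted \<open>A\<close> raises the index by one: tridiagonality enlarges
      the lower sum, and the shift removes the first component of the upper sum.\<close>
    let ?z = "A y - \<theta> (i + r) *s y"
    have "y \<in> lower_sum Vs (Suc (Suc i))" using y(1) lower_sum_mono[of "Suc i" "Suc (Suc i)" Vs] by auto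
    then have "?z \<in> lower_sum Vs (Suc (Suc i))"
      using tridiagonal_lower_sum[OF A Vs(2) y(1)]
      by (intro subspace_diff subspace_scale subspace_lower_sum)
    moreover have "?z \<in> upper_sum V (Suc i + r)" using eigen_upper_sum[OF A V(1) y(2)] by simp
    ultimately have "?z \<in> X" by (rule inX)
    moreover have "\<theta> (i + r) *s y \<in> X" using inX[OF y] sX by (intro subspace_scale)
    ultimately show "A y \<in> X" using subspace_cancel_add sX by blast
  qed
  moreover have "As x \<in> X" if "x \<in> X" for x
  proof (rule linear_span_into[OF As sX _ that[unfolded X_def]])
    fix y assume "y \<in> (\<Union>i. lower_sum Vs (Suc i) \<inter> upper_sum V (i + r))"
    then obtain i where y: "y \<in> lower_sum Vs (Suc i)" "y \<in> upper_sum V (i + r)" by auto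
    \<comment> \<open>Dually, the shifted \<open>As\<close> lowers the index by one. For
      \<open>i = 0\<close> there is no lower index, but then the result is zero.\<close>
    let ?z = "As y - \<theta>s i *s y"
    have z: "?z \<in> lower_sum Vs i" using eigen_lower_sum[OF As Vs(1) y(1)] .
    have "?z \<in> X"
    proof (cases i)
      case 0
      then show ?thesis using z subspace_0[OF sX] by (simp add: lower_sum_0)
    next
      case (Suc k)
      have y': "y \<in> upper_sum V (Suc (k + r))" using y(2) Suc by simp
      then have "y \<in> upper_sum V (k + r)" using upper_sum_antimono[of "k + r" "Suc (k + r)" V] by auto
      then have "?z \<in> upper_sum V (k + r)"
        using tridiagonal_upper_sum[OF As V(2) y']
        by (intro subspace_diff subspace_scale subspace_upper_sum)
      then show ?thesis using z Suc by (intro inX[of _ k]) auto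
    qed
    moreover have "\<theta>s i *s y \<in> X" using inX[OF y] sX by (intro subspace_scale)
    ultimately show "As y \<in> X" using subspace_cancel_add sX by blast
  qed
  ultimately show ?thesis using irr sX unfolding irreducible_pair_def by blast
qed

text \<open>The components span everything (shift \<open>r = 0\<close>), and the lower and upper
  sums at the same \<open>n\<close> meet only in zero (\<open>r = 1\<close>). Split a vector of the
  lower sum into components of index below \<open>n\<close> and the rest: the rest lies in both
  sums, hence vanishes.\<close>

lemma lower_sum_eq_split:
  assumes A: "Vector_Spaces.linear scale scale A" and As: "Vector_Spaces.linear scale scale As"
    and irr: "irreducible_pair A As"
    and V: "\<And>j v. v \<in> V j \<Longrightarrow> A v = \<theta> j *s v" "tridiagonal_on As V"
    and Vs: "\<And>j v. v \<in> Vs j \<Longrightarrow> As v = \<theta>s j *s v" "tridiagonal_on A Vs"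
    and V0: "upper_sum V 0 = UNIV" and V1: "upper_sum V 1 \<noteq> UNIV" and Vs0: "\<not> Vs 0 \<subseteq> {0}"
  shows "lower_sum Vs n = lower_sum (\<lambda>i. lower_sum Vs (Suc i) \<inter> upper_sum V i) n"
proof
  let ?U = "\<lambda>i. lower_sum Vs (Suc i) \<inter> upper_sum V i"
  have trivial: "span (\<Union>i. lower_sum Vs (Suc i) \<inter> upper_sum V (i + r)) = {0} \<or>
      span (\<Union>i. lower_sum Vs (Suc i) \<inter> upper_sum V (i + r)) = UNIV" for r :: nat
    by (rule diagonal_sum_trivial[OF A As irr V Vs])
  show "lower_sum ?U n \<subseteq> lower_sum Vs n"
    unfolding lower_sum_def[of ?U]
  proof (rule span_minimal[OF _ subspace_lower_sum])
    show "(\<Union>j<n. ?U j) \<subseteq> lower_sum Vs n" by (intro UN_least le_infI1 lower_sum_mono) auto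
  qed
  \<comment> \<open>The nonzero \<open>Vs 0\<close> lies in the sum of the components, which
    excludes the alternative \<open>{0}\<close>.\<close>
  have "Vs 0 \<subseteq> ?U 0" using subset_lower_sum[of 0 "Suc 0" Vs] V0 by auto
  also have "\<dots> \<subseteq> span (\<Union>i. ?U i)" by (rule order_trans[OF UN_upper span_superset]) (rule UNIV_I)
  finally have "span (\<Union>i. ?U i) \<noteq> {0}" using Vs0 by auto
  then have all: "span (\<Union>i. ?U i) = UNIV" using trivial[of 0] by simp
  have zero: "lower_sum Vs n \<inter> upper_sum V n = {0}"
  proof (cases n)
    case 0
    then show ?thesis using subspace_0[OF subspace_upper_sum] by (auto simp: lower_sum_0)
  next
    case (Suc k)
    \<comment> \<open>The sum for \<open>r = 1\<close> sits inside the proper subspace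
      \<open>upper_sum V 1\<close>, so it is zero; for \<open>n = k + 1\<close> the intersection in
      question is its term with index \<open>k\<close>.\<close>
    let ?X = "span (\<Union>i. lower_sum Vs (Suc i) \<inter> upper_sum V (i + 1))"
    have "?X \<subseteq> upper_sum V 1"
      by (intro span_minimal subspace_upper_sum UN_least le_infI2 upper_sum_antimono) auto
    then have "?X \<noteq> UNIV" using V1 by (auto simp only: top.extremum_unique)
    then have "?X = {0}" using trivial[of 1] by simp
    moreover have "lower_sum Vs n \<inter> upper_sum V n \<subseteq> ?X"
      unfolding Suc Suc_eq_plus1[of k, symmetric] by (intro subsetI span_base) auto
    ultimately show ?thesis
      using subspace_0[OF subspace_upper_sum] subspace_0[OF subspace_lower_sum] by blast
  qed
  show "lower_sum Vs n \<subseteq> lower_sum ?U n"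
  proof
    fix v assume v: "v \<in> lower_sum Vs n"
    have "UNIV = {..<n} \<union> {n..}" by auto
    then have "(\<Union>i. ?U i) = (\<Union>i<n. ?U i) \<union> (\<Union>i\<in>{n..}. ?U i)"
      by (metis UN_Un)
    then have "v \<in> span ((\<Union>i<n. ?U i) \<union> (\<Union>i\<in>{n..}. ?U i))" using all by simp
    then obtain x y where xy: "v = x + y" "x \<in> lower_sum ?U n" "y \<in> span (\<Union>i\<in>{n..}. ?U i)"
      unfolding span_Un lower_sum_def by blast
    have "x \<in> lower_sum Vs n" using xy(2) \<open>lower_sum ?U n \<subseteq> lower_sum Vs n\<close> by blast
    then have "y \<in> lower_sum Vs n" using subspace_diff[OF subspace_lower_sum v] xy(1) by force
    moreover have "span (\<Union>i\<in>{n..}. ?U i) \<subseteq> upper_sum V n"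
      by (intro span_minimal subspace_upper_sum UN_least le_infI2 upper_sum_antimono) auto
    ultimately have "y = 0" using xy(3) zero by blast
    then show "v \<in> lower_sum ?U n" using xy by simp
  qed
qed

section \<open>Eigenspaces of a map that is triangular on a flag\<close>

text \<open>Descent from the full space: on an eigenvector for \<open>\<mu> i\<close>, the shift by
  \<open>\<mu> (Suc n)\<close> with \<open>n \<ge> i\<close> is multiplication by a nonzero scalar,
  so landing one flag step lower puts the vector itself there.\<close>

lemma eigenspace_subset_flag:
  assumes flag: "\<And>n x. n \<le> d \<Longrightarrow> x \<in> L (Suc n) \<Longrightarrow> f x - \<mu> n *s x \<in> L n"
    and L: "\<And>n. subspace (L n)" "L (Suc d) = UNIV"
    and inj: "inj_on \<mu> {..d}" and i: "i \<le> d" and v: "f v = \<mu> i *s v"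
  shows "v \<in> L (Suc i)"
proof -
  have "v \<in> L (Suc n)" if "n \<le> d" "i \<le> n" for n
    using that
  proof (induction n rule: inc_induct)
    case (step n)
    let ?c = "\<mu> i - \<mu> (Suc n)"
    have "f v - \<mu> (Suc n) *s v = ?c *s v" using v by (simp add: algebra_simps)
    then have "?c *s v \<in> L (Suc n)" using flag[of "Suc n" v] step by auto
    then have "inverse ?c *s ?c *s v \<in> L (Suc n)" using L(1) by (rule subspace_scale[rotated])
    moreover have "?c \<noteq> 0" using inj step.hyps step.prems by (auto dest!: inj_onD)
    then have "inverse ?c *s ?c *s v = v" by simp
    ultimately show ?case by (simp only:)
  qed (simp add: L)
  then show ?thesis using i by simp
qed

text \<open>Distinct diagonal entries make a triangular map diagonalizable: a vector of
  \<open>L (Suc n)\<close> is corrected by eigenvectors from the induction hypothesis until it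
  becomes an eigenvector for \<open>\<mu> n\<close>.\<close>

lemma flag_subset_sum_eigenspaces:
  assumes f: "Vector_Spaces.linear scale scale f"
    and flag: "\<And>n x. n \<le> d \<Longrightarrow> x \<in> L (Suc n) \<Longrightarrow> f x - \<mu> n *s x \<in> L n"
    and L: "L 0 = {0}"
    and inj: "inj_on \<mu> {..d}" and n: "n \<le> Suc d"
  shows "L n \<subseteq> (\<Sum>j<n. eigenspace f (\<mu> j))"
  using n
proof (induction n)
  case (Suc n)
  interpret f: Vector_Spaces.linear scale scale f by fact
  show ?case
  proof
    fix v assume v: "v \<in> L (Suc n)"
    then have "f v - \<mu> n *s v \<in> (\<Sum>j<n. eigenspace f (\<mu> j))" using flag[of n v] Suc by auto
    then obtain w where w: "f v - \<mu> n *s v = sum w {..<n}" "\<And>j. j < n \<Longrightarrow> f (w j) = \<mu> j *s w j"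
      by (auto simp: set_sum_alt eigenspace_def)
    \<comment> \<open>Chosen so that the shift of \<open>f\<close> by \<open>\<mu> n\<close> sends
      \<open>y j\<close> to \<open>w j\<close>; subtracting all \<open>y j\<close> from
      \<open>v\<close> then leaves a vector killed by that shift.\<close>
    define y where "y j = inverse (\<mu> j - \<mu> n) *s w j" for j
    have y: "f (y j) = \<mu> j *s y j" if "j < n" for j
      using w(2)[OF that] by (simp add: y_def f.scale mult.commute)
    have y': "f (y j) - \<mu> n *s y j = w j" if "j < n" for j
    proof -
      have "\<mu> j \<noteq> \<mu> n" using inj that Suc.prems by (auto dest: inj_onD)
      then have "(\<mu> j - \<mu> n) *s y j = w j" by (simp add: y_def)
      then show ?thesis unfolding y[OF that] by (simp only: scale_left_diff_distrib)
    qed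
    let ?u = "v - (\<Sum>j<n. y j)"
    have "f ?u - \<mu> n *s ?u = (f v - \<mu> n *s v) - (\<Sum>j<n. f (y j) - \<mu> n *s y j)"
      by (simp add: f.diff f.sum scale_right_diff_distrib scale_sum_right sum_subtractf)
    also have "\<dots> = 0" using y' w(1) by simp
    finally have "f ?u = \<mu> n *s ?u" by simp
    then have "\<forall>j\<in>{..<Suc n}. (y(n := ?u)) j \<in> eigenspace f (\<mu> j)"
      using y by (auto simp: eigenspace_def less_Suc_eq)
    moreover have "v = sum (y(n := ?u)) {..<Suc n}" by simp
    ultimately show "v \<in> (\<Sum>j<Suc n. eigenspace f (\<mu> j))" unfolding set_sum_alt[OF finite_lessThan] by blast
  qed
qed (simp add: L)

section \<open>Eigenvalues, padding and reversal of orderings\<close>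

text \<open>Members of \<open>eigenspaces\<close> contain a nonzero vector, which makes the scalar
  described by \<open>eigenvalue_on\<close> unique.\<close>

lemma eigenspace_eigenvalue_on:
  assumes "Vector_Spaces.linear scale scale f" and "U \<in> eigenspaces f"
  shows "U = eigenspace f (eigenvalue_on f U)"
proof -
  obtain \<theta> where \<theta>: "U = eigenspace f \<theta>" "U \<noteq> {0}" using assms(2) unfolding eigenspaces_def by auto
  interpret f: Vector_Spaces.linear scale scale f by fact
  have "0 \<in> U" using \<theta>(1) by (simp add: eigenspace_def f.zero)
  then obtain u where "u \<in> U" "u \<noteq> 0" using \<theta>(2) by auto
  then have "eigenvalue_on f U = \<theta>" using \<theta>(1) by (intro eigenvalue_on_eqI) (auto simp: eigenspace_def)
  then show ?thesis using \<theta>(1) by simp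
qed

lemma tridiagonal_on_padded:
  assumes "standard_ordering f g d V"
    and g: "Vector_Spaces.linear scale scale g"
  shows "tridiagonal_on g (\<lambda>j. if j \<le> d then V j else {0})"
  unfolding tridiagonal_on_def
proof
  interpret g: Vector_Spaces.linear scale scale g by fact
  fix j
  let ?V = "\<lambda>j. if j \<le> d then V j else {0}"
  let ?S = "span (?V (j - 1) \<union> ?V j \<union> ?V (Suc j))"
  show "g ` ?V j \<subseteq> ?S"
  proof (cases "j \<le> d")
    case True
    have in_S: "x \<in> ?S" if "x \<in> ?V (j - 1) \<or> x \<in> ?V j \<or> x \<in> ?V (Suc j)" for x
      using that by (intro span_base) blast
    have "(if j = 0 then {0} else V (j - 1)) + V j + (if j = d then {0} else V (j + 1)) \<subseteq> ?S"
    proof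
      fix v assume "v \<in> (if j = 0 then {0} else V (j - 1)) + V j + (if j = d then {0} else V (j + 1))"
      then obtain x y z where v: "v = x + y + z" and x: "x \<in> (if j = 0 then {0} else V (j - 1))"
        and y: "y \<in> V j" and z: "z \<in> (if j = d then {0} else V (j + 1))"
        by (elim set_plus_elim) blast
      have "x \<in> ?S"
      proof (cases "j = 0")
        case True then show ?thesis using x span_zero by simp
      next
        case False
        then have "j - 1 \<le> d" using True by simp
        then show ?thesis using x False by (intro in_S disjI1) simp
      qed
      moreover have "y \<in> ?S" using y True by (intro in_S) simp
      moreover have "z \<in> ?S"
      proof (cases "j = d")
        case True then show ?thesis using z span_zero by simp
      next
        case False then show ?thesis using z True by (intro in_S) simp
      qed
      ultimately show "v \<in> ?S" unfolding v by (intro span_add)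
    qed
    moreover have "g ` V j \<subseteq> (if j = 0 then {0} else V (j - 1)) + V j + (if j = d then {0} else V (j + 1))"
      using assms(1) True unfolding standard_ordering_def by blast
    ultimately have "g ` V j \<subseteq> ?S" by (rule order_trans[rotated])
    then show ?thesis using True by (simp only: if_True)
  qed (simp add: g.zero span_zero)
qed

text \<open>Reversing the eigenspaces of \<open>A\<close> turns the second split decomposition into
  one of the first kind, so a single argument covers both \<open>K\<close> and
  \<open>B\<close>.\<close>

lemma standard_ordering_rev:
  assumes "standard_ordering f g d V"
  shows "standard_ordering f g d (\<lambda>i. V (d - i))"
proof -
  have "bij_betw (\<lambda>i. d - i) {..d} {..d}" by (rule bij_betw_byWitness[where f' = "\<lambda>i. d - i"]) auto
  then have "bij_betw (\<lambda>i. V (d - i)) {..d} (eigenspaces f)"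
    using assms bij_betw_trans unfolding standard_ordering_def comp_def by blast
  moreover have "g ` V (d - i) \<subseteq> (if i = 0 then {0} else V (d - (i - 1))) + V (d - i)
      + (if i = d then {0} else V (d - (i + 1)))" if "i \<le> d" for i
  proof -
    have "g ` V (d - i) \<subseteq> (if d - i = 0 then {0} else V (d - i - 1)) + V (d - i)
        + (if d - i = d then {0} else V (d - i + 1))"
      using assms unfolding standard_ordering_def by (meson diff_le_self)
    \<comment> \<open>Reversal exchanges the two boundary cases; with truncated subtraction they
      need separate care, as they coincide for \<open>d = 0\<close>.\<close>
    moreover have "(d - i = 0) = (i = d)" "(d - i = d) = (i = 0 \<or> d = 0)" using that by auto
    moreover have "d - i + 1 = d - (i - 1)" if "i \<noteq> 0" using \<open>i \<le> d\<close> that by simp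
    ultimately show ?thesis using that by (auto simp: add_ac split: if_splits)
  qed
  ultimately show ?thesis unfolding standard_ordering_def by blast
qed

lemma TD_system_rev:
  "TD_system d A E As Es \<Longrightarrow> TD_system d A (\<lambda>i. E (d - i)) As Es"
  unfolding TD_system_def using standard_ordering_rev[of A As d "\<lambda>i. range (E i)"]
  by (meson diff_le_self)

lemma split_U_down_eq:
  assumes "i \<le> d"
  shows "split_U_down d E Es i = split_U d (\<lambda>i. E (d - i)) Es i"
proof -
  have "(\<Sum>j\<in>{0..d - i}. range (E j)) = (\<Sum>j\<in>{i..d}. range (E (d - j)))"
    using assms by (intro sum.reindex_bij_witness[of _ "\<lambda>j. d - j" "\<lambda>j. d - j"]) auto
  then show ?thesis by (simp add: split_U_down_def split_U_def)
qed

section \<open>The flag of a TD system and its split components\<close>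

context
  fixes d A E As Es
  assumes TD: "TD_system d A E As Es"
begin

lemma TD_linear: "Vector_Spaces.linear scale scale A" "Vector_Spaces.linear scale scale As"
  using TD unfolding TD_system_def TD_pair_def by auto

lemma TD_ranges:
  assumes "i \<le> d"
  shows "range (E i) \<in> eigenspaces A" "range (Es i) \<in> eigenspaces As"
  using TD assms unfolding TD_system_def primitive_idempotent_def by auto

lemma TD_inj: "inj_on (\<lambda>i. range (E i)) {..d}"
  using TD unfolding TD_system_def standard_ordering_def bij_betw_def by auto

lemma TD_range_subspace:
  assumes "i \<le> d"
  shows "subspace (range (E i))" "subspace (range (Es i))"
proof -
  have E: "Vector_Spaces.linear scale scale (E i)" and Es: "Vector_Spaces.linear scale scale (Es i)"
    using TD assms unfolding TD_system_def primitive_idempotent_def by auto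
  interpret E: Vector_Spaces.linear scale scale "E i" by fact
  interpret Es: Vector_Spaces.linear scale scale "Es i" by fact
  show "subspace (range (E i))" "subspace (range (Es i))"
    using E.subspace_image Es.subspace_image subspace_UNIV by blast+
qed

lemma TD_eigen:
  assumes "i \<le> d"
  shows "v \<in> range (E i) \<Longrightarrow> A v = eigenvalue_on A (range (E i)) *s v"
    and "v \<in> range (Es i) \<Longrightarrow> As v = eigenvalue_on As (range (Es i)) *s v"
proof -
  show "v \<in> range (E i) \<Longrightarrow> A v = eigenvalue_on A (range (E i)) *s v"
    by (subst (asm) eigenspace_eigenvalue_on[OF TD_linear(1) TD_ranges(1)[OF assms]])
      (simp add: eigenspace_def)
  show "v \<in> range (Es i) \<Longrightarrow> As v = eigenvalue_on As (range (Es i)) *s v"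
    by (subst (asm) eigenspace_eigenvalue_on[OF TD_linear(2) TD_ranges(2)[OF assms]])
      (simp add: eigenspace_def)
qed

lemma TD_span:
  "span (\<Union>i\<in>{..d}. range (E i)) = UNIV" "span (\<Union>i\<in>{..d}. range (Es i)) = UNIV"
  using TD unfolding TD_system_def TD_pair_def diagonalizable_def standard_ordering_def bij_betw_def
  by auto

text \<open>Instance of \<open>lower_sum_eq_split\<close> for the zero-padded eigenspace sequences;
  up to \<open>Suc d\<close> the padding does not affect lower sums.\<close>

lemma lower_sum_split_U:
  assumes "n \<le> Suc d"
  shows "lower_sum (\<lambda>i. range (Es i)) n = lower_sum (split_U d E Es) n"
proof -
  interpret lin: Vector_Spaces.linear scale scale A by (rule TD_linear)
  interpret lins: Vector_Spaces.linear scale scale As by (rule TD_linear)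
  let ?V = "\<lambda>j. if j \<le> d then range (E j) else {0}"
  let ?Vs = "\<lambda>j. if j \<le> d then range (Es j) else {0}"
  have lower: "lower_sum ?Vs m = lower_sum (\<lambda>i. range (Es i)) m" if "m \<le> Suc d" for m
    unfolding lower_sum_def using that by (intro arg_cong[where f = span]) auto
  have upper: "upper_sum ?V i = span (\<Union>j\<in>{i..d}. range (E j))" for i
    unfolding upper_sum_def
  proof (intro antisym span_minimal subspace_span)
    show "(\<Union>j\<in>{i..}. ?V j) \<subseteq> span (\<Union>j\<in>{i..d}. range (E j))"
      by (auto intro!: span_base span_zero split: if_splits)
    show "(\<Union>j\<in>{i..d}. range (E j)) \<subseteq> span (\<Union>j\<in>{i..}. ?V j)"
      by (force intro!: span_base)
  qed
  have V0: "upper_sum ?V 0 = UNIV" using TD_span(1) by (simp add: upper atLeast0AtMost)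
  \<comment> \<open>\<open>E 0\<close> vanishes on all later components; if these spanned the space,
    its range would be zero and not an eigenspace.\<close>
  have V1: "upper_sum ?V 1 \<noteq> UNIV"
  proof
    assume top: "upper_sum ?V 1 = UNIV"
    have P: "primitive_idempotent A (range (E 0)) (E 0)" using TD unfolding TD_system_def by auto
    then have E0: "Vector_Spaces.linear scale scale (E 0)" unfolding primitive_idempotent_def by auto
    interpret E0: Vector_Spaces.linear scale scale "E 0" by fact
    have "E 0 v \<in> {0}" for v
    proof (rule linear_span_into[OF E0])
      show "v \<in> span (\<Union>j\<in>{1..}. ?V j)" using top unfolding upper_sum_def by simp
      fix x assume "x \<in> (\<Union>j\<in>{1..}. ?V j)"
      then obtain j where j: "j \<ge> 1" "x \<in> ?V j" by blast
      show "E 0 x \<in> {0}"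
      proof (cases "j \<le> d")
        case True
        then have "range (E j) \<noteq> range (E 0)" using j inj_onD[OF TD_inj, of j 0] by auto
        moreover have "x \<in> range (E j)" using j True by (simp only: if_True)
        ultimately have "E 0 x = 0"
          using P TD_ranges(1)[OF True] unfolding primitive_idempotent_def by blast
        then show ?thesis by simp
      qed (use j E0.zero in simp)
    qed simp
    then have "range (E 0) = {0}" by auto
    then show False using TD_ranges(1)[of 0] by (auto simp: eigenspaces_def)
  qed
  have Vs0: "\<not> ?Vs 0 \<subseteq> {0}"
    using TD_ranges(2)[of 0] by (auto simp: eigenspaces_def eigenspace_def)
  have U: "split_U d E Es i = lower_sum ?Vs (Suc i) \<inter> upper_sum ?V i" if "i \<le> d" for i
  proof -
    have "(\<Sum>j\<in>{0..i}. range (Es j)) = lower_sum ?Vs (Suc i)"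
      using that TD_range_subspace
      by (subst sum_eq_span) (auto simp: lower lower_sum_def lessThan_Suc_atMost atLeast0AtMost)
    moreover have "(\<Sum>j\<in>{i..d}. range (E j)) = upper_sum ?V i"
      unfolding upper using TD_range_subspace by (intro sum_eq_span) auto
    ultimately show ?thesis by (simp add: split_U_def)
  qed
  have "lower_sum (\<lambda>i. range (Es i)) n = lower_sum ?Vs n" using lower assms by simp
  also have "\<dots> = lower_sum (\<lambda>i. lower_sum ?Vs (Suc i) \<inter> upper_sum ?V i) n"
  proof (rule lower_sum_eq_split[OF TD_linear])
    show "irreducible_pair A As"
      using TD unfolding TD_system_def TD_pair_def irreducible_pair_def by blast
    show "tridiagonal_on As ?V" "tridiagonal_on A ?Vs"
      using TD TD_linear TD_range_subspace unfolding TD_system_def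
      by (auto intro!: tridiagonal_on_padded)
    \<comment> \<open>For \<open>j > d\<close> the only vector is zero, so the unspecified value of
      \<open>eigenvalue_on\<close> does no harm.\<close>
    show "A v = eigenvalue_on A (range (E j)) *s v" if "v \<in> ?V j" for j v
      using that TD_eigen(1)[of j v] by (cases "j \<le> d") (auto simp: lin.zero)
    show "As v = eigenvalue_on As (range (Es j)) *s v" if "v \<in> ?Vs j" for j v
      using that TD_eigen(2)[of j v] by (cases "j \<le> d") (auto simp: lins.zero)
  qed (fact V0 V1 Vs0)+
  also have "\<dots> = lower_sum (split_U d E Es) n"
    unfolding lower_sum_def[of _ n] using U assms by (intro arg_cong[where f = span]) auto
  finally show ?thesis .
qed

text \<open>\<open>F\<close> is scalar on split components, whose partial sums form the flag of
  \<open>As\<close>; hence \<open>F\<close> is triangular on that flag.\<close>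

lemma acts_on_split_U:
  assumes "acts_on_decomposition d q (split_U d E Es) F" and "n \<le> d"
    and "x \<in> lower_sum (\<lambda>i. range (Es i)) (Suc n)"
  shows "F x - q powi (int d - 2 * int n) *s x \<in> lower_sum (\<lambda>i. range (Es i)) n"
proof -
  have "F x - q powi (int d - 2 * int n) *s x \<in> lower_sum (split_U d E Es) n"
    using assms lower_sum_split_U[of "Suc n"] unfolding acts_on_decomposition_def
    by (intro eigen_lower_sum) auto
  then show ?thesis using lower_sum_split_U[of n] assms(2) by simp
qed

end

section \<open>Scalars of q-Racah type and the inclusion for \<open>W_space\<close>\<close>

text \<open>Both parts come from distinctness of the eigenvalues of \<open>A\<close>: equal powers
  of \<open>q\<close> have equal inverses and give equal eigenvalues, and
  \<open>a = inverse a\<close> would identify those at \<open>0\<close> and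
  \<open>d\<close>.\<close>

lemma q_Racah_distinct:
  assumes TD: "TD_system d A E As Es" and qR: "q_Racah d A E As Es q a b"
  shows "inj_on (\<lambda>i. q powi (int d - 2 * int i)) {..d}"
    and "d \<ge> 1 \<Longrightarrow> a \<noteq> inverse a"
proof -
  let ?\<theta> = "\<lambda>i. a * q powi (int d - 2 * int i) + inverse a * q powi (2 * int i - int d)"
  have \<theta>: "i = j" if "i \<le> d" "j \<le> d" "?\<theta> i = ?\<theta> j" for i j
  proof -
    have "eigenvalue_on A (range (E i)) = eigenvalue_on A (range (E j))"
      using that qR unfolding q_Racah_def by auto
    then have "range (E i) = range (E j)"
      using eigenspace_eigenvalue_on[OF TD_linear(1)[OF TD] TD_ranges(1)[OF TD]] that by metis
    then show ?thesis using TD_inj[OF TD] that by (auto dest: inj_onD)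
  qed
  show "inj_on (\<lambda>i. q powi (int d - 2 * int i)) {..d}"
  proof (rule inj_onI)
    fix i j assume ij: "i \<in> {..d}" "j \<in> {..d}" "q powi (int d - 2 * int i) = q powi (int d - 2 * int j)"
    have "q powi (2 * int i - int d) = inverse (q powi (int d - 2 * int i))" for i
      by (simp flip: power_int_minus)
    then show "i = j" using ij by (intro \<theta>) auto
  qed
  show "a \<noteq> inverse a" if "d \<ge> 1"
  proof
    assume "a = inverse a"
    then have "?\<theta> 0 = ?\<theta> d" by (simp add: add.commute)
    then show False using \<theta>[of 0 d] that by simp
  qed
qed

lemma shift_W_space_subset:
  assumes d: "d \<ge> 1" and TD: "TD_system d A E As Es" and qR: "q_Racah d A E As Es q a b"
    and K: "acts_on_decomposition d q (split_U d E Es) K"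
    and B: "acts_on_decomposition d q (split_U_down d E Es) B"
    and i: "i \<le> d"
  shows "(\<lambda>v. As v - eigenvalue_on As (range (Es i)) *s v) ` W_space d q a K B i
    \<subseteq> (\<Sum>j<i. W_space d q a K B j)"
proof -
  let ?L = "lower_sum (\<lambda>i. range (Es i))"
  let ?\<mu> = "\<lambda>i. q powi (int d - 2 * int i)"
  let ?M = "M_map a K B"
  have B': "acts_on_decomposition d q (split_U d (\<lambda>i. E (d - i)) Es) B"
    using B split_U_down_eq unfolding acts_on_decomposition_def by auto
  interpret K: Vector_Spaces.linear scale scale K using K unfolding acts_on_decomposition_def by simp
  interpret B: Vector_Spaces.linear scale scale B using B unfolding acts_on_decomposition_def by simp
  have M: "Vector_Spaces.linear scale scale ?M"
    by unfold_locales (auto simp: M_map_def K.add K.scale B.add B.scale algebra_simps)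
  note inj = q_Racah_distinct(1)[OF TD qR] and a = q_Racah_distinct(2)[OF TD qR d]
  have flag: "?M x - ?\<mu> n *s x \<in> ?L n" if "n \<le> d" "x \<in> ?L (Suc n)" for n x
  proof -
    \<comment> \<open>The coefficients of \<open>K\<close> and \<open>B\<close> in
      \<open>M_map\<close> add up to one, so the shift of \<open>M_map\<close> is the same
      combination of the shifts of \<open>K\<close> and \<open>B\<close>.\<close>
    have "?\<mu> n *s x = inverse (a - inverse a) *s ((a - inverse a) *s ?\<mu> n *s x)" using a by simp
    also have "\<dots> = inverse (a - inverse a) *s (a *s ?\<mu> n *s x - inverse a *s ?\<mu> n *s x)"
      by (simp only: scale_left_diff_distrib)
    finally have "?M x - ?\<mu> n *s x = inverse (a - inverse a) *s
        (a *s (K x - ?\<mu> n *s x) - inverse a *s (B x - ?\<mu> n *s x))"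
      unfolding M_map_def by (simp only: scale_right_diff_distrib) (simp add: algebra_simps)
    then show ?thesis
      by (simp only:) (intro subspace_scale subspace_diff[OF subspace_lower_sum] subspace_lower_sum
          acts_on_split_U[OF TD K that] acts_on_split_U[OF TD_system_rev[OF TD] B' that])
  qed
  have top: "?L (Suc d) = UNIV"
    using TD_span(2)[OF TD] by (simp add: lower_sum_def lessThan_Suc_atMost)
  have "As v - eigenvalue_on As (range (Es i)) *s v \<in> (\<Sum>j<i. W_space d q a K B j)"
    if "v \<in> W_space d q a K B i" for v
  proof -
    have "?M v = ?\<mu> i *s v" using that by (simp add: W_space_def eigenspace_def)
    then have "v \<in> ?L (Suc i)"
      using eigenspace_subset_flag[of d ?L ?M ?\<mu>] flag subspace_lower_sum top inj i by blast
    \<comment> \<open>Both flag inclusions are used: the eigenvector lies in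
      \<open>?L (Suc i)\<close>, the shifted \<open>As\<close> moves it into \<open>?L i\<close>,
      and that is covered by the earlier eigenspaces of \<open>?M\<close>.\<close>
    then have "As v - eigenvalue_on As (range (Es i)) *s v \<in> ?L i"
      using TD_linear(2)[OF TD] TD_eigen(2)[OF TD] i
      by (intro eigen_lower_sum[where \<theta> = "\<lambda>i. eigenvalue_on As (range (Es i))"]) auto
    also have "?L i \<subseteq> (\<Sum>j<i. eigenspace ?M (?\<mu> j))"
      using flag_subset_sum_eigenspaces[where L = ?L, OF M flag lower_sum_0 inj] i by simp
    finally show ?thesis by (simp add: W_space_def)
  qed
  then show ?thesis by blast
qed

end

theorem lemma9p5:
  fixes scale :: "'k::alg_closed_field \<Rightarrow> 'v::ab_group_add \<Rightarrow> 'v"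
    and Basis :: "'v set"
    and d :: nat
    and A As K B :: "'v \<Rightarrow> 'v"
    and E Es :: "nat \<Rightarrow> 'v \<Rightarrow> 'v"
    and q a b :: 'k
  assumes "finite_dimensional_vector_space scale Basis"
    and "vector_space.dim scale (UNIV :: 'v set) > 0"
    and "d \<ge> 1"
    and "TD_space.TD_system scale d A E As Es"
    and "TD_space.q_Racah scale d A E As Es q a b"
    and "TD_space.acts_on_decomposition scale d q (TD_space.split_U d E Es) K"
    and "TD_space.acts_on_decomposition scale d q (TD_space.split_U_down d E Es) B"
  shows "\<forall>i\<le>d.
    (\<lambda>v. As v - scale (TD_space.eigenvalue_on scale As (range (Es i))) v)
        ` TD_space.W_space scale d q a K B i
      \<subseteq> (\<Sum>j<i. TD_space.W_space scale d q a K B j)"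
proof -
  interpret finite_dimensional_vector_space scale Basis by fact
  interpret TD_space scale ..
  show ?thesis by (intro allI impI shift_W_space_subset[OF assms(3-7)])
qed

end
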